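(* Let $R$ and $S$ be rings, $J$ a proper ideal of $S$, $\varphi:R\to S$ a ring homomorphism, and $I$ a proper ideal of $R$. If $I$ is a quasi sdf-absorbing ideal of $R$, then $I\bowtie^{\varphi}J$ is a quasi sdf-absorbing ideal of $R\bowtie^{\varphi}J$.
   Context: All rings are commutative with identity. An ideal $I$ of a ring $R$ is called sdf-absorbing if for all non-zero $a,b\in R$, $a^{2}-b^{2}\in I$ implies $a-b\in I$ or $a+b\in I$. A proper ideal $I$ of $R$ is called quasi sdf-absorbing if its radical $\sqrt{I}$ is an sdf-absorbing ideal of $R$. The amalgamation of $R$ with $S$ along $J$ with respect to $\varphi$ is the subring $R\bowtie^{\varphi}J:=\{(r,\varphi(r)+j)\mid r\in R,\ j\in J\}$ of $R\times S$. For an ideal $I$ of $R$, $I\bowtie^{\varphi}J:=\{(r,\varphi(r)+j)\mid r\in I,\ j\in J\}$, which is an ideal of $R\bowtie^{\varphi}J$. *)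

theory Defs
  imports "HOL-Algebra.Algebra"
begin

definition ideal_radical :: "('a, 'm) ring_scheme \<Rightarrow> 'a set \<Rightarrow> 'a set"
  where "ideal_radical R I = {x \<in> carrier R. \<exists>n::nat. n > 0 \<and> x [^]\<^bsub>R\<^esub> n \<in> I}"

(* Properness is not part of this notion. *)
locale sdf_absorbing_ideal = ideal I R + cring R for I and R (structure) +
  assumes sdf_absorbing:
    "\<lbrakk>a \<in> carrier R; b \<in> carrier R; a \<noteq> \<zero>; b \<noteq> \<zero>; a [^] (2::nat) \<ominus> b [^] (2::nat) \<in> I\<rbrakk>
      \<Longrightarrow> a \<ominus> b \<in> I \<or> a \<oplus> b \<in> I"

locale quasi_sdf_absorbing_ideal = ideal I R + cring R for I and R (structure) +
  assumes I_proper: "I \<noteq> carrier R"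
    and radical_sdf_absorbing: "sdf_absorbing_ideal (ideal_radical R I) R"

definition amalg_set :: "('b, 'n) ring_scheme \<Rightarrow> ('a \<Rightarrow> 'b) \<Rightarrow> 'a set \<Rightarrow> 'b set \<Rightarrow> ('a \<times> 'b) set"
  where "amalg_set S \<phi> I J = {(r, \<phi> r \<oplus>\<^bsub>S\<^esub> j) | r j. r \<in> I \<and> j \<in> J}"

definition amalgamation ::
    "('a, 'm) ring_scheme \<Rightarrow> ('b, 'n) ring_scheme \<Rightarrow> ('a \<Rightarrow> 'b) \<Rightarrow> 'b set \<Rightarrow> ('a \<times> 'b) ring"
  where "amalgamation R S \<phi> J = (RDirProd R S)\<lparr>carrier := amalg_set S \<phi> (carrier R) J\<rparr>"

end

(* The first projection is a ring homomorphism from the amalgamation to R, and the ideal in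
   question is the preimage of I under it, because the second component of an element lies in
   phi(r) + J automatically.  Taking radicals commutes with preimages.  A homomorphism may send
   non-zero elements to zero, but for a radical ideal the condition defining sdf-absorption
   holds trivially when a = 0 or b = 0, so quasi sdf-absorption is preserved by preimages. *)

theory Submission
  imports Defs
begin

text \<open>Exponents multiply: \<open>(x^n)^m = x^(n * m)\<close>, and \<open>n * m\<close> is
  again positive.\<close>

lemma mem_ideal_radical_if_pow_mem:
  assumes "monoid R" "x \<in> carrier R" "x [^]\<^bsub>R\<^esub> n \<in> ideal_radical R I" "(n::nat) > 0"
  shows "x \<in> ideal_radical R I"
proof -
  interpret monoid R by fact
  obtain m :: nat where "m > 0" "(x [^]\<^bsub>R\<^esub> n) [^]\<^bsub>R\<^esub> m \<in> I"
    using assms(3) unfolding ideal_radical_def by blast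
  then have "n * m > 0" "x [^]\<^bsub>R\<^esub> (n * m) \<in> I"
    using assms(2,4) by (auto simp: nat_pow_pow)
  then show ?thesis
    using assms(2) unfolding ideal_radical_def by blast
qed

lemma (in quasi_sdf_absorbing_ideal) radical_absorbs:
  assumes a: "a \<in> carrier R" and b: "b \<in> carrier R"
    and diff: "a [^] (2::nat) \<ominus> b [^] (2::nat) \<in> ideal_radical R I"
  shows "a \<ominus> b \<in> ideal_radical R I \<or> a \<oplus> b \<in> ideal_radical R I"
proof -
  interpret Q: sdf_absorbing_ideal "ideal_radical R I" R
    by (rule radical_sdf_absorbing)
  have root: "x \<in> ideal_radical R I"
    if "x \<in> carrier R" "x [^] (2::nat) \<in> ideal_radical R I" for x
    using that by (rule mem_ideal_radical_if_pow_mem[OF monoid_axioms]) simp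
  consider "a = \<zero>" | "b = \<zero>" | "a \<noteq> \<zero>" "b \<noteq> \<zero>" by blast
  then show ?thesis
  proof cases
    case 1
    \<comment> \<open>With \<open>a\<close> zero the difference collapses to minus the square of
      \<open>b\<close>; \<open>root\<close> then puts \<open>b\<close> itself into the radical, and
      \<open>a \<oplus> b = b\<close>.\<close>
    have "\<ominus> (b [^] (2::nat)) \<in> ideal_radical R I"
      using diff b 1 by (simp add: minus_eq nat_pow_zero)
    then have "b [^] (2::nat) \<in> ideal_radical R I"
      using b Q.a_inv_closed[of "\<ominus> (b [^] (2::nat))"] by simp
    then show ?thesis using root[OF b] b 1 by simp
  next
    case 2
    have "a [^] (2::nat) \<in> ideal_radical R I"
      using diff a 2 by (simp add: minus_eq nat_pow_zero)
    then show ?thesis using root[OF a] a 2 by simp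
  next
    case 3
    then show ?thesis using Q.sdf_absorbing a b diff by blast
  qed
qed

text \<open>Since \<open>h (r^n) = (h r)^n\<close>, one and the same exponent serves both
  sides.\<close>

lemma (in ring_hom_cring) ideal_radical_vimage:
  "ideal_radical R {r \<in> carrier R. h r \<in> I} = {r \<in> carrier R. h r \<in> ideal_radical S I}"
  unfolding ideal_radical_def by auto

lemma (in ring_hom_cring) quasi_sdf_absorbing_ideal_vimage:
  assumes "quasi_sdf_absorbing_ideal I S"
  shows "quasi_sdf_absorbing_ideal {r \<in> carrier R. h r \<in> I} R"
proof -
  interpret I: quasi_sdf_absorbing_ideal I S by fact
  interpret Q: sdf_absorbing_ideal "ideal_radical S I" S
    by (rule I.radical_sdf_absorbing)
  \<comment> \<open>The unit witnesses properness: \<open>h\<close> sends one to one, so the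
    preimage misses the one of \<open>R\<close>.\<close>
  have "\<one>\<^bsub>S\<^esub> \<notin> I"
    using I.one_imp_carrier I.I_proper by blast
  then have proper: "{r \<in> carrier R. h r \<in> I} \<noteq> carrier R"
    using hom_one R.one_closed by force
  have "sdf_absorbing_ideal {r \<in> carrier R. h r \<in> ideal_radical S I} R"
  proof (intro sdf_absorbing_ideal.intro sdf_absorbing_ideal_axioms.intro)
    show "ideal {r \<in> carrier R. h r \<in> ideal_radical S I} R"
      by (rule ring.ideal_vimage[OF Q.ideal_axioms])
  next
    fix a b
    assume "a \<in> carrier R" "b \<in> carrier R"
      and "a [^] (2::nat) \<ominus> b [^] (2::nat) \<in> {r \<in> carrier R. h r \<in> ideal_radical S I}"
    then show "a \<ominus> b \<in> {r \<in> carrier R. h r \<in> ideal_radical S I}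
        \<or> a \<oplus> b \<in> {r \<in> carrier R. h r \<in> ideal_radical S I}"
      \<comment> \<open>\<open>h a\<close> or \<open>h b\<close> may vanish for non-zero
        \<open>a\<close> and \<open>b\<close>, hence \<open>radical_absorbs\<close> in place of
        \<open>Q.sdf_absorbing\<close>.\<close>
      using I.radical_absorbs[of "h a" "h b"] by simp
  qed (rule R.cring_axioms)
  then show ?thesis
    using proper ring.ideal_vimage[OF I.ideal_axioms] R.cring_axioms
    by (intro quasi_sdf_absorbing_ideal.intro quasi_sdf_absorbing_ideal_axioms.intro)
      (simp_all add: ideal_radical_vimage)
qed

lemma RDirProd_simps:
  "(r, s) \<otimes>\<^bsub>RDirProd R S\<^esub> (r', s') = (r \<otimes>\<^bsub>R\<^esub> r', s \<otimes>\<^bsub>S\<^esub> s')"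
  "(r, s) \<oplus>\<^bsub>RDirProd R S\<^esub> (r', s') = (r \<oplus>\<^bsub>R\<^esub> r', s \<oplus>\<^bsub>S\<^esub> s')"
  "\<one>\<^bsub>RDirProd R S\<^esub> = (\<one>\<^bsub>R\<^esub>, \<one>\<^bsub>S\<^esub>)"
  "\<zero>\<^bsub>RDirProd R S\<^esub> = (\<zero>\<^bsub>R\<^esub>, \<zero>\<^bsub>S\<^esub>)"
  by (simp_all add: RDirProd_def DirProd_def monoid.defs)

text \<open>Negation is derived from addition rather than stored in the ring record, so it is
  identified by uniqueness of additive inverses.\<close>

lemma RDirProd_a_inv:
  assumes "ring R" "ring S" "r \<in> carrier R" "s \<in> carrier S"
  shows "\<ominus>\<^bsub>RDirProd R S\<^esub> (r, s) = (\<ominus>\<^bsub>R\<^esub> r, \<ominus>\<^bsub>S\<^esub> s)"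
proof -
  interpret R: ring R by fact
  interpret S: ring S by fact
  interpret P: ring "RDirProd R S" by (rule RDirProd_ring[OF assms(1,2)])
  show ?thesis
    using assms(3,4)
    by (intro P.minus_equality) (simp_all add: RDirProd_simps RDirProd_carrier R.l_neg S.l_neg)
qed

lemma RDirProd_cring:
  assumes "cring R" "cring S"
  shows "cring (RDirProd R S)"
proof -
  interpret R: cring R by fact
  interpret S: cring S by fact
  interpret P: ring "RDirProd R S"
    by (rule RDirProd_ring[OF R.ring_axioms S.ring_axioms])
  show ?thesis
    by unfold_locales (auto simp: RDirProd_simps RDirProd_carrier R.m_comm S.m_comm)
qed

lemma (in ring_hom_ring) subring_amalg_set:
  assumes "ideal J S"
  shows "subring (amalg_set S h (carrier R) J) (RDirProd R S)"
proof -
  interpret J: ideal J S by fact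
  interpret P: ring "RDirProd R S"
    by (rule RDirProd_ring[OF R.ring_axioms S.ring_axioms])
  have mem: "(r, h r \<oplus>\<^bsub>S\<^esub> j) \<in> amalg_set S h (carrier R) J" if "r \<in> carrier R" "j \<in> J" for r j
    using that unfolding amalg_set_def by blast
  note [simp] = J.Icarr
  show ?thesis
  proof (rule P.subringI)
    show "amalg_set S h (carrier R) J \<subseteq> carrier (RDirProd R S)"
      by (auto simp: amalg_set_def RDirProd_carrier)
    show "\<one>\<^bsub>RDirProd R S\<^esub> \<in> amalg_set S h (carrier R) J"
      \<comment> \<open>The unit is the pair for \<open>r = 1\<close> and \<open>j = 0\<close>, as
        \<open>h\<close> preserves one.\<close>
      using mem[of \<one> "\<zero>\<^bsub>S\<^esub>"] by (simp add: RDirProd_simps)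
  next
    fix x assume "x \<in> amalg_set S h (carrier R) J"
    then obtain r j where x: "x = (r, h r \<oplus>\<^bsub>S\<^esub> j)" and r: "r \<in> carrier R" and j: "j \<in> J"
      unfolding amalg_set_def by blast
    show "\<ominus>\<^bsub>RDirProd R S\<^esub> x \<in> amalg_set S h (carrier R) J"
      using mem[of "\<ominus> r" "\<ominus>\<^bsub>S\<^esub> j"] r j
      by (simp add: x RDirProd_a_inv R.ring_axioms S.ring_axioms S.minus_add)
  next
    fix x y assume "x \<in> amalg_set S h (carrier R) J" "y \<in> amalg_set S h (carrier R) J"
    then obtain r j r' j'
      where x: "x = (r, h r \<oplus>\<^bsub>S\<^esub> j)" and y: "y = (r', h r' \<oplus>\<^bsub>S\<^esub> j')"
        and [simp]: "r \<in> carrier R" "r' \<in> carrier R" "j \<in> J" "j' \<in> J"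
      unfolding amalg_set_def by blast
    show "x \<oplus>\<^bsub>RDirProd R S\<^esub> y \<in> amalg_set S h (carrier R) J"
      using mem[of "r \<oplus> r'" "j \<oplus>\<^bsub>S\<^esub> j'"]
      by (simp add: x y RDirProd_simps S.a_ac)
    \<comment> \<open>This is what remains of \<open>(h r + j) (h r' + j')\<close> after splitting
      off \<open>h r h r' = h (r r')\<close>; each summand has a factor in the ideal
      \<open>J\<close>.\<close>
    have "h r \<otimes>\<^bsub>S\<^esub> j' \<oplus>\<^bsub>S\<^esub> j \<otimes>\<^bsub>S\<^esub> (h r' \<oplus>\<^bsub>S\<^esub> j') \<in> J"
      by (intro J.a_closed J.I_l_closed J.I_r_closed) simp_all
    then show "x \<otimes>\<^bsub>RDirProd R S\<^esub> y \<in> amalg_set S h (carrier R) J"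
      using mem[of "r \<otimes> r'" "h r \<otimes>\<^bsub>S\<^esub> j' \<oplus>\<^bsub>S\<^esub> j \<otimes>\<^bsub>S\<^esub> (h r' \<oplus>\<^bsub>S\<^esub> j')"]
      by (simp add: x y RDirProd_simps S.a_ac S.l_distr S.r_distr)
  qed
qed

lemma (in ring_hom_cring) cring_amalgamation:
  assumes "ideal J S"
  shows "cring (amalgamation R S h J)"
proof -
  interpret P: cring "RDirProd R S"
    by (rule RDirProd_cring[OF R.cring_axioms S.cring_axioms])
  have "subring (amalg_set S h (carrier R) J) (RDirProd R S)"
    by (rule ring.subring_amalg_set[OF assms])
  then show ?thesis
    unfolding amalgamation_def
    \<comment> \<open>The amalgamation is the product ring with its carrier restricted to a subring,
      so commutativity is inherited.\<close>
    using P.subcringI' P.subcring_iff subringE(1) by blast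
qed

lemma fst_ring_hom_amalgamation:
  "fst \<in> ring_hom (amalgamation R S \<phi> J) R"
  by (auto simp: ring_hom_def amalgamation_def amalg_set_def RDirProd_simps)

text \<open>In any representation \<open>(r, \<phi> r + j)\<close> of \<open>x\<close>, the element
  \<open>r\<close> is forced to be \<open>fst x\<close>; \<open>I \<subseteq> carrier R\<close>
  places the left side inside the amalgamation.\<close>

lemma amalg_set_eq_vimage_fst:
  assumes "I \<subseteq> carrier R"
  shows "amalg_set S \<phi> I J = {x \<in> carrier (amalgamation R S \<phi> J). fst x \<in> I}"
  using assms by (auto simp: amalgamation_def amalg_set_def)

theorem mainTheorem6:
  fixes R :: "('a, 'm) ring_scheme" and S :: "('b, 'n) ring_scheme"
    and \<phi> :: "'a \<Rightarrow> 'b" and I :: "'a set" and J :: "'b set"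
  assumes "cring R" and "cring S"
    and "ideal J S" and "J \<noteq> carrier S"
    and "\<phi> \<in> ring_hom R S"
    and "ideal I R" and "I \<noteq> carrier R"
    and "quasi_sdf_absorbing_ideal I R"
  shows "quasi_sdf_absorbing_ideal (amalg_set S \<phi> I J) (amalgamation R S \<phi> J)"
proof -
  interpret \<phi>: ring_hom_cring R S \<phi>
    using assms by (intro UnivPoly.ring_hom_cringI)
  interpret I: ideal I R by fact
  interpret pr: ring_hom_cring "amalgamation R S \<phi> J" R fst
    using \<phi>.cring_amalgamation assms(1,3) fst_ring_hom_amalgamation
    by (intro UnivPoly.ring_hom_cringI)
  show ?thesis
    \<comment> \<open>The preimage lemma is applied to the projection \<open>fst\<close>, not to
      \<open>\<phi>\<close>.\<close>
    using pr.quasi_sdf_absorbing_ideal_vimage[OF assms(8)]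
    by (simp add: amalg_set_eq_vimage_fst[OF I.a_subset])
qed

end
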